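(* Let $a\in\mathbb{R}$, $n\in\mathbb{Z}_+$, $\alpha\in(n-1,n)$, and let $x:\mathbb{N}_{a+1-n}\to\mathbb{R}$ and $w:\mathbb{N}_{a+1-n}\to\mathbb{R}\setminus\{0\}$. Then for every $k\in\mathbb{N}_{a+1}$: $${}_a^{\rm R}\nabla_k^{\alpha,w(k)}x(k)={}_a^{\rm G}\nabla_k^{\alpha,w(k)}x(k),$$ $${}_a^{\rm R}\nabla_k^{\alpha,w(k)}x(k)={}_a^{\rm C}\nabla_k^{\alpha,w(k)}x(k)+\sum_{i=0}^{n-1}\frac{(k-a)^{\overline{i-\alpha}}}{\Gamma(i-\alpha+1)}\,\frac{w(a)}{w(k)}\,\bigl[\nabla^{i,w(k)}x(k)\bigr]_{k=a},$$ $${}_a^{\rm G}\nabla_k^{-\alpha,w(k)}x(k)=\nabla^{n,w(k)}\,{}_a^{\rm G}\nabla_k^{-\alpha-n,w(k)}x(k).$$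
   Context: For $b\in\mathbb{R}$, $\mathbb{N}_b=\{b,b+1,b+2,\dots\}$; $\mathbb{Z}_+=\{1,2,\dots\}$. $p^{\overline{q}}=\Gamma(p+q)/\Gamma(p)$ is the rising function. $\binom{p}{i}=\frac{p(p-1)\cdots(p-i+1)}{i!}$ for real $p$ and integer $i\ge 0$. Nabla difference: $\nabla^n z(k)=\sum_{i=0}^n(-1)^i\binom{n}{i}z(k-i)$, with $\nabla^0 z=z$. Grünwald–Letnikov difference/sum of order $\alpha\in\mathbb{R}$: ${}_a^{\rm G}\nabla_k^\alpha z(k)=\sum_{i=0}^{k-a-1}(-1)^i\binom{\alpha}{i}z(k-i)$; empty sums are $0$, so this equals $0$ at $k=a,a-1,\dots$. For $\alpha\in(n-1,n)$, Riemann–Liouville: ${}_a^{\rm R}\nabla_k^\alpha z(k)=\nabla^n\,{}_a^{\rm G}\nabla_k^{\alpha-n}z(k)$; Caputo: ${}_a^{\rm C}\nabla_k^\alpha z(k)={}_a^{\rm G}\nabla_k^{\alpha-n}\nabla^n z(k)$. Tempered versions, with tempered function $w$ (nowhere zero): for each of the operators $D\in\{\nabla^n,\ {}_a^{\rm G}\nabla_k^\alpha,\ {}_a^{\rm R}\nabla_k^\alpha,\ {}_a^{\rm C}\nabla_k^\alpha\}$ the tempered operator (written with the extra superscript $w(k)$) sends $x$ to $w^{-1}(k)\,D[w(k)x(k)]$, where $w^{-1}(k)=1/w(k)$. $[\,\cdot\,]_{k=a}$ denotes evaluation at $k=a$. *)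

theory Defs
  imports "HOL-Analysis.Gamma_Function"
begin

definition nat_shift :: "real \<Rightarrow> real set" where
  "nat_shift b = range (\<lambda>i::nat. b + real i)"

definition rising :: "real \<Rightarrow> real \<Rightarrow> real" where
  "rising p q = Gamma (p + q) / Gamma p"

text \<open>
  Functions on a shifted copy of the naturals are represented by total functions on the reals;
  only their values on the shifted copy are relevant.
\<close>

definition nabla :: "nat \<Rightarrow> (real \<Rightarrow> real) \<Rightarrow> real \<Rightarrow> real" where
  "nabla n z k = (\<Sum>i=0..n. (-1) ^ i * real (n choose i) * z (k - real i))"

text \<open>
  The upper summation limit \<open>k - a - 1\<close> is a real number that may be negative, so the index set is
  written as a set of naturals. It is empty, and the sum is zero, for \<open>k = a, a - 1, \<dots>\<close>.
\<close>

definition gl_nabla :: "real \<Rightarrow> real \<Rightarrow> (real \<Rightarrow> real) \<Rightarrow> real \<Rightarrow> real" where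
  "gl_nabla a \<alpha> z k =
     (\<Sum>i\<in>{i::nat. real i \<le> k - a - 1}. (-1) ^ i * (\<alpha> gchoose i) * z (k - real i))"

text \<open>
  The Riemann--Liouville and Caputo differences are meant for orders \<open>\<alpha>\<close> strictly between \<open>n - 1\<close>
  and \<open>n\<close> with \<open>n\<close> a positive integer; this \<open>n\<close> is \<open>nat \<lceil>\<alpha>\<rceil>\<close>.
\<close>

definition rl_nabla :: "real \<Rightarrow> real \<Rightarrow> (real \<Rightarrow> real) \<Rightarrow> real \<Rightarrow> real" where
  "rl_nabla a \<alpha> z = (let n = nat \<lceil>\<alpha>\<rceil> in nabla n (gl_nabla a (\<alpha> - real n) z))"

definition caputo_nabla :: "real \<Rightarrow> real \<Rightarrow> (real \<Rightarrow> real) \<Rightarrow> real \<Rightarrow> real" where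
  "caputo_nabla a \<alpha> z = (let n = nat \<lceil>\<alpha>\<rceil> in gl_nabla a (\<alpha> - real n) (nabla n z))"

definition tempered ::
    "(real \<Rightarrow> real) \<Rightarrow> ((real \<Rightarrow> real) \<Rightarrow> real \<Rightarrow> real) \<Rightarrow> (real \<Rightarrow> real) \<Rightarrow> real \<Rightarrow> real" where
  "tempered w D x k = 1 / w k * D (\<lambda>j. w j * x j) k"

end

theory Submission
  imports Defs
begin

text \<open>
  With \<open>z = w x\<close> everything reduces to untempered operators. Pascal's rule for the kernel
  \<open>(-1)^i (\<beta> gchoose i)\<close> shows that applying \<open>\<nabla>\<close> after the Gruenwald--Letnikov operator raises its
  order by one. Applying \<open>\<nabla>\<close> before it does the same up to one boundary term at \<open>a\<close>, since \<open>\<nabla> z\<close>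
  involves \<open>z a\<close>, which the Gruenwald--Letnikov operator does not see. Iterating \<open>n\<close> times gives
  all three identities; the boundary kernels are quotients of Gamma values.
\<close>

lemma nabla_0 [simp]: "nabla 0 z = z"
  by (simp add: nabla_def fun_eq_iff)

lemma nabla_cong:
  assumes "\<And>i. i \<le> n \<Longrightarrow> f (k - real i) = g (k - real i)"
  shows "nabla n f k = nabla n g k"
  unfolding nabla_def by (rule sum.cong) (use assms in auto)

lemma nabla_Suc: "nabla (Suc n) z k = nabla n z k - nabla n z (k - 1)"
proof -
  have "nabla (Suc n) z k =
      z k + (\<Sum>i\<le>n. (-1) ^ Suc i * real (Suc n choose Suc i) * z (k - real (Suc i)))"
    unfolding nabla_def atLeast0AtMost by (subst sum.atMost_Suc_shift) simp
  also have "\<dots> = z k + (\<Sum>i\<le>n. (-1) ^ Suc i * real (n choose Suc i) * z (k - real (Suc i)))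
      - (\<Sum>i\<le>n. (-1) ^ i * real (n choose i) * z (k - 1 - real i))"
    by (simp add: algebra_simps sum.distrib sum_subtractf sum_negf)
  \<comment> \<open>The range may grow to \<open>Suc n\<close> after the shift because
    \<open>n choose Suc n\<close> is 0.\<close>
  also have "z k + (\<Sum>i\<le>n. (-1) ^ Suc i * real (n choose Suc i) * z (k - real (Suc i))) =
      (\<Sum>i\<le>Suc n. (-1) ^ i * real (n choose i) * z (k - real i))"
    by (subst sum.atMost_Suc_shift) simp
  also have "\<dots> = nabla n z k"
    by (simp add: nabla_def atLeast0AtMost)
  finally show ?thesis
    by (simp add: nabla_def atLeast0AtMost)
qed

lemma gl_nabla_below: "k < a + 1 \<Longrightarrow> gl_nabla a \<beta> z k = 0"
  unfolding gl_nabla_def by (rule sum.neutral) auto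

lemma gl_nabla_lattice:
  assumes "k = a + real m"
  shows "gl_nabla a \<beta> z k = (\<Sum>i<m. (-1) ^ i * (\<beta> gchoose i) * z (k - real i))"
proof -
  have "{i. real i \<le> k - a - 1} = {..<m}"
    using assms by auto
  then show ?thesis
    by (simp add: gl_nabla_def)
qed

text \<open>Pascal's rule for the kernel. With \<open>f i = z (k - real i)\<close> the shorter
  second sum is exactly the operator at \<open>k - 1\<close>, but lacks the term
  \<open>i = m\<close> of the operator applied to the shifted \<open>z\<close> at \<open>k\<close>;
  this is where the boundary term comes from.\<close>

lemma gbinomial_signed_sum_Suc:
  fixes \<beta> :: real
  shows "(\<Sum>i<Suc m. (-1) ^ i * (\<beta> + 1 gchoose i) * f i) =
    (\<Sum>i<Suc m. (-1) ^ i * (\<beta> gchoose i) * f i) - (\<Sum>i<m. (-1) ^ i * (\<beta> gchoose i) * f (Suc i))"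
  unfolding sum.lessThan_Suc_shift gbinomial_Suc_Suc
  by (simp add: algebra_simps sum.distrib sum_subtractf sum_negf)

lemma gl_nabla_plus_one:
  assumes "k = a + real m"
  shows "gl_nabla a (\<beta> + 1) z k = gl_nabla a \<beta> z k - gl_nabla a \<beta> z (k - 1)"
proof (cases m)
  case 0
  then show ?thesis
    using assms by (simp add: gl_nabla_below)
next
  case (Suc l)
  then have "k - 1 = a + real l"
    using assms by simp
  then show ?thesis
    unfolding gl_nabla_lattice[OF assms] gl_nabla_lattice[OF \<open>k - 1 = a + real l\<close>] Suc
    by (subst gbinomial_signed_sum_Suc) (simp add: algebra_simps)
qed

text \<open>The offset \<open>m\<close> is an integer because the outer differences may step below
  \<open>a\<close>, where both sides vanish; hence no boundary term appears.\<close>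

lemma nabla_gl_nabla:
  assumes "k = a + of_int m"
  shows "nabla n (gl_nabla a \<beta> z) k = gl_nabla a (\<beta> + real n) z k"
  using assms
proof (induction n arbitrary: k m)
  case 0
  show ?case by simp
next
  case (Suc n)
  have "nabla (Suc n) (gl_nabla a \<beta> z) k =
      gl_nabla a (\<beta> + real n) z k - gl_nabla a (\<beta> + real n) z (k - 1)"
    unfolding nabla_Suc using Suc.IH[of k m] Suc.IH[of "k - 1" "m - 1"] Suc.prems by simp
  also have "\<dots> = gl_nabla a (\<beta> + real n + 1) z k"
  proof (cases "m \<ge> 0")
    case True
    then show ?thesis
      using gl_nabla_plus_one[of k a "nat m"] Suc.prems by simp
  next
    case False
    then have "of_int m \<le> (0::real)" by simp
    then show ?thesis
      using Suc.prems by (simp add: gl_nabla_below)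
  qed
  finally show ?case
    by (simp add: algebra_simps)
qed

lemma gl_nabla_plus_one_boundary:
  assumes "k = a + real (Suc m)"
  shows "gl_nabla a (\<beta> + 1) z k =
    gl_nabla a \<beta> (\<lambda>j. z j - z (j - 1)) k + (-1) ^ m * (\<beta> gchoose m) * z a"
proof -
  have "z (k - 1 - real m) = z a"
    using assms by simp
  then show ?thesis
    unfolding gl_nabla_lattice[OF assms] gbinomial_signed_sum_Suc
    by (simp add: algebra_simps sum.distrib sum_subtractf)
qed

text \<open>The hypothesis is used at \<open>\<beta> + 1\<close>; the remaining unit of order is
  then moved onto \<open>nabla n z\<close>, which adds the term \<open>i = n\<close> with kernel
  \<open>\<beta> gchoose m\<close>.\<close>

lemma gl_nabla_plus_of_nat_boundary:
  assumes "k = a + real (Suc m)"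
  shows "gl_nabla a (\<beta> + real n) z k = gl_nabla a \<beta> (nabla n z) k +
    (\<Sum>i<n. (-1) ^ m * (\<beta> + real n - 1 - real i gchoose m) * nabla i z a)"
proof (induction n arbitrary: \<beta>)
  case 0
  show ?case by simp
next
  case (Suc n)
  have "(\<lambda>j. nabla n z j - nabla n z (j - 1)) = nabla (Suc n) z"
    by (simp add: nabla_Suc fun_eq_iff)
  then show ?case
    using Suc.IH[of "\<beta> + 1"] gl_nabla_plus_one_boundary[OF assms, of \<beta> "nabla n z"]
    by (simp add: algebra_simps)
qed

text \<open>The sign turns the binomial into \<open>pochhammer (- \<gamma>) m / fact m\<close>, a
  Gamma quotient away from the poles, and \<open>fact m\<close> is the
  \<open>Gamma (real (Suc m))\<close> in the denominator of \<open>rising\<close>.\<close>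

lemma gbinomial_kernel_eq_rising:
  fixes \<gamma> :: real
  assumes "- \<gamma> \<notin> \<int>\<^sub>\<le>\<^sub>0"
  shows "(-1) ^ m * (\<gamma> gchoose m) = rising (real (Suc m)) (- \<gamma> - 1) / Gamma (- \<gamma>)"
proof -
  have "(-1) ^ m * (\<gamma> gchoose m) = pochhammer (- \<gamma>) m / fact m"
    by (simp add: gbinomial_pochhammer flip: power_mult_distrib)
  also have "\<dots> = Gamma (- \<gamma> + real m) / Gamma (- \<gamma>) / fact m"
    by (simp add: pochhammer_Gamma[OF assms])
  also have "\<dots> = rising (real (Suc m)) (- \<gamma> - 1) / Gamma (- \<gamma>)"
    using Gamma_fact[of m, where 'a = real]
    by (simp add: rising_def algebra_simps)
  finally show ?thesis .
qed

theorem theorem1: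
  fixes a \<alpha> :: real and n :: nat and x w :: "real \<Rightarrow> real"
  assumes "n \<ge> 1"
    and "real n - 1 < \<alpha>" and "\<alpha> < real n"
    and "\<And>j. j \<in> nat_shift (a + 1 - real n) \<Longrightarrow> w j \<noteq> 0"
  shows "\<forall>k \<in> nat_shift (a + 1).
      tempered w (rl_nabla a \<alpha>) x k = tempered w (gl_nabla a \<alpha>) x k \<and>
      tempered w (rl_nabla a \<alpha>) x k =
        tempered w (caputo_nabla a \<alpha>) x k +
        (\<Sum>i=0..n-1. rising (k - a) (real i - \<alpha>) / Gamma (real i - \<alpha> + 1) *
           (w a / w k) * tempered w (nabla i) x a) \<and>
      tempered w (gl_nabla a (-\<alpha>)) x k =
        tempered w (nabla n) (tempered w (gl_nabla a (-\<alpha> - real n)) x) k"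
proof
  fix k assume "k \<in> nat_shift (a + 1)"
  then obtain m where k: "k = a + real (Suc m)"
    by (auto simp: nat_shift_def)
  then have k_int: "k = a + of_int (int (Suc m))"
    by simp
  define z where "z = (\<lambda>j. w j * x j)"
  have "\<lceil>\<alpha>\<rceil> = int n"
    using assms(2,3) by (intro ceiling_unique) auto
  then have ceil: "nat \<lceil>\<alpha>\<rceil> = n"
    by simp
  \<comment> \<open>These are the points that \<open>nabla n\<close> reads at \<open>k\<close>; the
    lowest possible one is \<open>a + 1 - real n\<close>.\<close>
  have w_nz: "w (k - real i) \<noteq> 0" if "i \<le> n" for i
  proof (rule assms(4))
    have "k - real i = a + 1 - real n + real (m + (n - i))"
      using k that by (simp add: of_nat_diff)
    then show "k - real i \<in> nat_shift (a + 1 - real n)"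
      unfolding nat_shift_def by blast
  qed
  have "a = a + 1 - real n + real (n - 1)"
    using assms(1) by (simp add: of_nat_diff)
  then have "a \<in> nat_shift (a + 1 - real n)"
    unfolding nat_shift_def by blast
  then have w_a: "w a \<noteq> 0"
    by (rule assms(4))
  \<comment> \<open>A value \<open>- real j\<close> would make \<alpha> the integer
    \<open>i + j + 1\<close>, strictly between \<open>n - 1\<close> and \<open>n\<close>.\<close>
  have alpha_not_int: "real i - \<alpha> + 1 \<notin> \<int>\<^sub>\<le>\<^sub>0" for i
  proof
    assume "real i - \<alpha> + 1 \<in> \<int>\<^sub>\<le>\<^sub>0"
    then obtain j where "real i - \<alpha> + 1 = - real j"
      by (auto elim!: nonpos_Ints_cases')
    then have "real (n - 1) < real (i + j + 1)" "real (i + j + 1) < real n"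
      using assms(1-3) by (simp_all add: of_nat_diff)
    then show False
      unfolding of_nat_less_iff by linarith
  qed
  have rl: "rl_nabla a \<alpha> z k = gl_nabla a \<alpha> z k"
    by (simp add: rl_nabla_def ceil nabla_gl_nabla[OF k_int])
  have kernel: "(-1) ^ m * (\<alpha> - 1 - real i gchoose m) =
      rising (k - a) (real i - \<alpha>) / Gamma (real i - \<alpha> + 1)" for i
    using gbinomial_kernel_eq_rising[of "\<alpha> - 1 - real i" m] alpha_not_int[of i] k
    by (simp add: algebra_simps)
  have boundary: "gl_nabla a \<alpha> z k = caputo_nabla a \<alpha> z k +
      (\<Sum>i=0..n-1. rising (k - a) (real i - \<alpha>) / Gamma (real i - \<alpha> + 1) * nabla i z a)"
  proof -
    have "{..<n} = {0..n - 1}"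
      using assms(1) by auto
    then show ?thesis
      using gl_nabla_plus_of_nat_boundary[OF k, of "\<alpha> - real n" n z]
      by (simp add: caputo_nabla_def ceil kernel)
  qed
  have "tempered w (rl_nabla a \<alpha>) x k = tempered w (gl_nabla a \<alpha>) x k"
    using rl by (simp add: tempered_def z_def)
  moreover have "tempered w (gl_nabla a \<alpha>) x k = tempered w (caputo_nabla a \<alpha>) x k +
      (\<Sum>i=0..n-1. rising (k - a) (real i - \<alpha>) / Gamma (real i - \<alpha> + 1) *
         (w a / w k) * tempered w (nabla i) x a)"
    \<comment> \<open>The factor \<open>w a\<close> cancels the \<open>1 / w a\<close> inside the
      tempered difference at \<open>a\<close>.\<close>
    using w_a boundary
    by (simp add: tempered_def add_divide_distrib sum_divide_distrib flip: z_def)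
  moreover have "tempered w (gl_nabla a (-\<alpha>)) x k =
      tempered w (nabla n) (tempered w (gl_nabla a (-\<alpha> - real n)) x) k"
  proof -
    \<comment> \<open>The inner \<open>1 / w j\<close> cancels only where \<open>w\<close> is
      nonzero, so the functions are compared just at the points \<open>k - real i\<close> with
      \<open>i \<le> n\<close>.\<close>
    have "nabla n (\<lambda>j. w j * tempered w (gl_nabla a (-\<alpha> - real n)) x j) k =
        nabla n (gl_nabla a (-\<alpha> - real n) z) k"
      by (rule nabla_cong) (simp add: tempered_def z_def w_nz)
    also have "\<dots> = gl_nabla a (-\<alpha>) z k"
      by (simp add: nabla_gl_nabla[OF k_int])
    finally show ?thesis
      by (simp add: tempered_def z_def)
  qed
  ultimately show "tempered w (rl_nabla a \<alpha>) x k = tempered w (gl_nabla a \<alpha>) x k \<and>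
      tempered w (rl_nabla a \<alpha>) x k =
        tempered w (caputo_nabla a \<alpha>) x k +
        (\<Sum>i=0..n-1. rising (k - a) (real i - \<alpha>) / Gamma (real i - \<alpha> + 1) *
           (w a / w k) * tempered w (nabla i) x a) \<and>
      tempered w (gl_nabla a (-\<alpha>)) x k =
        tempered w (nabla n) (tempered w (gl_nabla a (-\<alpha> - real n)) x) k"
    by simp
qed

end
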